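(* Let $N=N_1N_2$ with $N_1,N_2\ge 1$. Every QC-LDPC code with parity-check matrix $H$ and lifting factor (circulant size) $N$ is equivalent to a pre-lifted QC-LDPC code with pre-lift size (first lifting factor) $N_1$ and circulant size (second lifting factor) $N_2$.
   Context: A protograph is an $n_c\times n_v$ matrix $(b_{ij})$ of non-negative integers. A QC-LDPC code with lifting factor $N$ is given by an $n_cN\times n_vN$ parity-check matrix $H$ obtained by replacing each $b_{ij}$ by a sum of $b_{ij}$ distinct $N\times N$ circulant permutation matrices (the zero matrix if $b_{ij}=0$). A pre-lifted QC-LDPC code with first lifting factor $N_1$ and second lifting factor $N_2$ from the same protograph is given by a parity-check matrix obtained in two steps: first, each $b_{ij}$ is replaced by a sum (over $\mathbb Z$) of $b_{ij}$ (not necessarily distinct) $N_1\times N_1$ circulant permutation matrices, giving an $n_cN_1\times n_vN_1$ non-negative integer matrix; second, each entry $e$ of that matrix is replaced by a sum of $e$ distinct $N_2\times N_2$ circulant permutation matrices (the zero matrix if $e=0$). Two codes given by parity-check matrices are equivalent here if one parity-check matrix can be obtained from the other by permuting rows and permuting columns (so the Tanner graphs are isomorphic). *)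

theory Defs
  imports "Jordan_Normal_Form.Matrix" "HOL-Combinatorics.Permutations"
begin

text \<open>
  Protographs and parity-check matrices are matrices over the natural numbers, so every sum
  of circulant permutation matrices below is a sum of integers; the entries of a lifted
  parity-check matrix turn out to be 0 or 1 because its circulants are distinct.
\<close>

definition circ_perm_mat :: "nat \<Rightarrow> nat \<Rightarrow> nat mat" where
  "circ_perm_mat N s = mat N N (\<lambda>(i, j). if j = (i + s) mod N then 1 else 0)"

definition is_circ_perm_mat :: "nat \<Rightarrow> nat mat \<Rightarrow> bool" where
  "is_circ_perm_mat N P \<longleftrightarrow> (\<exists>s<N. P = circ_perm_mat N s)"

definition mat_sum_list :: "nat \<Rightarrow> nat mat list \<Rightarrow> nat mat" where
  "mat_sum_list N Ps = foldr (+) Ps (0\<^sub>m N N)"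

definition block :: "nat \<Rightarrow> nat mat \<Rightarrow> nat \<Rightarrow> nat \<Rightarrow> nat mat" where
  "block N H i j = mat N N (\<lambda>(r, c). H $$ (i * N + r, j * N + c))"

definition is_multi_lift :: "nat \<Rightarrow> nat mat \<Rightarrow> nat mat \<Rightarrow> bool" where
  "is_multi_lift N B H \<longleftrightarrow>
     H \<in> carrier_mat (dim_row B * N) (dim_col B * N) \<and>
     (\<forall>i<dim_row B. \<forall>j<dim_col B. \<exists>Ps.
        length Ps = B $$ (i, j) \<and> (\<forall>P\<in>set Ps. is_circ_perm_mat N P) \<and>
        block N H i j = mat_sum_list N Ps)"

definition is_simple_lift :: "nat \<Rightarrow> nat mat \<Rightarrow> nat mat \<Rightarrow> bool" where
  "is_simple_lift N B H \<longleftrightarrow>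
     H \<in> carrier_mat (dim_row B * N) (dim_col B * N) \<and>
     (\<forall>i<dim_row B. \<forall>j<dim_col B. \<exists>Ps.
        length Ps = B $$ (i, j) \<and> distinct Ps \<and> (\<forall>P\<in>set Ps. is_circ_perm_mat N P) \<and>
        block N H i j = mat_sum_list N Ps)"

definition qc_ldpc :: "nat mat \<Rightarrow> nat \<Rightarrow> nat mat \<Rightarrow> bool" where
  "qc_ldpc B N H \<longleftrightarrow> is_simple_lift N B H"

definition prelifted_qc_ldpc :: "nat mat \<Rightarrow> nat \<Rightarrow> nat \<Rightarrow> nat mat \<Rightarrow> bool" where
  "prelifted_qc_ldpc B N1 N2 H \<longleftrightarrow> (\<exists>H1. is_multi_lift N1 B H1 \<and> is_simple_lift N2 H1 H)"

definition equivalent_pcm :: "nat mat \<Rightarrow> nat mat \<Rightarrow> bool" where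
  "equivalent_pcm H H' \<longleftrightarrow>
     (\<exists>p q. p permutes {..<dim_row H} \<and> q permutes {..<dim_col H} \<and>
        H' = mat (dim_row H) (dim_col H) (\<lambda>(i, j). H $$ (p i, q j)))"

end

theory Submission
  imports Defs "HOL-Number_Theory.Cong"
begin

text \<open>
  Inside each block of size \<open>N = N1 * N2\<close>, move the index \<open>v * N1 + u\<close> to position \<open>u * N2 + v\<close>
  (\<open>u < N1\<close>, \<open>v < N2\<close>). A circulant of shift \<open>s\<close> sends \<open>v * N1 + u\<close> to
  \<open>(v * N1 + u + s) mod N\<close>, whose two digits are \<open>(u + s) mod N1\<close> and
  \<open>(v + (u + s) div N1) mod N2\<close>. Hence, after the permutation, it is the circulant of shift
  \<open>s mod N1\<close> in which the 1 in row \<open>u\<close> is lifted to the circulant of shift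
  \<open>(u + s) div N1 mod N2\<close>. For fixed \<open>u\<close> these two digits determine \<open>s\<close> modulo \<open>N\<close>, so distinct
  circulants of size \<open>N\<close> give distinct circulants of size \<open>N2\<close> in each position.
\<close>

section \<open>Mixed-radix arithmetic of indices\<close>

lemma add_mult_less:
  fixes i m n r :: nat
  assumes "i < m" "r < n"
  shows "i * n + r < m * n"
proof -
  have "i * n + r < Suc i * n" using assms by simp
  also have "\<dots> \<le> m * n" using assms by (intro mult_le_mono1) simp
  finally show ?thesis .
qed

text \<open>Reduction modulo \<open>m * n\<close> keeps the lowest base-\<open>m\<close> digit and
  reduces the quotient modulo \<open>n\<close>, so comparing both digits decides equality.\<close>

lemma digits_eq_mod_iff:
  fixes u v x m n :: nat
  assumes "u < m"
  shows "v * m + u = x mod (m * n) \<longleftrightarrow> u = x mod m \<and> v = (x div m) mod n"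
proof
  assume eq: "v * m + u = x mod (m * n)"
  have "(v * m + u) mod m = x mod m" "(v * m + u) div m = x div m mod n"
    unfolding eq using assms by (simp_all add: mod_mult2_eq)
  with assms show "u = x mod m \<and> v = (x div m) mod n"
    by simp
qed (simp add: mod_mult2_eq mult.commute)

lemma mod_add_left_inj:
  fixes a s t n :: nat
  assumes "(a + s) mod n = (a + t) mod n" "s < n" "t < n"
  shows "s = t"
proof -
  have "[a + s = a + t] (mod n)" using assms(1) by (simp add: cong_def)
  then have "[s = t] (mod n)" by (simp only: cong_add_lcancel_nat)
  with assms(2,3) show ?thesis by (simp add: cong_def)
qed

section \<open>Sums of circulants as lists of shifts\<close>

text \<open>Matrix sums become counts over shift lists. Repeated shifts are counted with
  multiplicity, so the formula serves both lifting steps.\<close>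

lemma mat_sum_list_circ:
  "mat_sum_list N (map (circ_perm_mat N) ss) =
     mat N N (\<lambda>(r, c). length (filter (\<lambda>s. c = (r + s) mod N) ss))"
proof (induction ss)
  case Nil
  show ?case by (rule eq_matI) (auto simp: mat_sum_list_def)
next
  case (Cons s ss)
  have "mat_sum_list N (map (circ_perm_mat N) (s # ss)) =
      circ_perm_mat N s + mat_sum_list N (map (circ_perm_mat N) ss)"
    by (simp add: mat_sum_list_def)
  also have "\<dots> = mat N N (\<lambda>(r, c). length (filter (\<lambda>s. c = (r + s) mod N) (s # ss)))"
    unfolding Cons.IH by (rule eq_matI) (auto simp: circ_perm_mat_def)
  finally show ?case .
qed

lemma circ_perm_mat_inj_on: "inj_on (circ_perm_mat N) {..<N}"
proof (rule inj_onI)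
  fix s t assume st: "s \<in> {..<N}" "t \<in> {..<N}" and eq: "circ_perm_mat N s = circ_perm_mat N t"
  \<comment> \<open>The column of the single 1 in row 0 is the shift itself.\<close>
  have "circ_perm_mat N s $$ (0, s) = circ_perm_mat N t $$ (0, s)" by (simp only: eq)
  with st show "s = t" by (auto simp: circ_perm_mat_def split: if_splits)
qed

lemma is_circ_perm_mat_mod: "N > 0 \<Longrightarrow> is_circ_perm_mat N (circ_perm_mat N (s mod N))"
  unfolding is_circ_perm_mat_def by (intro exI[of _ "s mod N"]) simp

lemma circ_perm_mat_list_shifts:
  assumes "\<forall>P\<in>set Ps. is_circ_perm_mat N P"
  obtains ss where "Ps = map (circ_perm_mat N) ss" "set ss \<subseteq> {..<N}"
proof -
  have "\<exists>ss. Ps = map (circ_perm_mat N) ss \<and> set ss \<subseteq> {..<N}"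
    using assms
  proof (induction Ps)
    case (Cons P Ps)
    then obtain ss s where "Ps = map (circ_perm_mat N) ss" "set ss \<subseteq> {..<N}"
      "P = circ_perm_mat N s" "s < N"
      by (auto simp: is_circ_perm_mat_def)
    then show ?case by (intro exI[of _ "s # ss"]) simp
  qed simp
  with that show ?thesis by blast
qed

text \<open>Fixes one shift list per block as a function of the block position, so that the main
  proof handles only entries of \<open>H\<close> and numbers. Distinct circulants force distinct
  shifts.\<close>

lemma simple_lift_shifts:
  assumes "is_simple_lift N B H"
  obtains ss where
    "\<And>i j. i < dim_row B \<Longrightarrow> j < dim_col B \<Longrightarrow>
       length (ss i j) = B $$ (i, j) \<and> distinct (ss i j) \<and> set (ss i j) \<subseteq> {..<N}"
    "\<And>i j r c. i < dim_row B \<Longrightarrow> j < dim_col B \<Longrightarrow> r < N \<Longrightarrow> c < N \<Longrightarrow>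
       H $$ (i * N + r, j * N + c) = length (filter (\<lambda>s. c = (r + s) mod N) (ss i j))"
proof -
  have "\<exists>ss. length ss = B $$ (i, j) \<and> distinct ss \<and> set ss \<subseteq> {..<N} \<and>
      (\<forall>r<N. \<forall>c<N. H $$ (i * N + r, j * N + c) = length (filter (\<lambda>s. c = (r + s) mod N) ss))"
    if ij: "i < dim_row B" "j < dim_col B" for i j
  proof -
    obtain Ps where Ps: "length Ps = B $$ (i, j)" "distinct Ps" "\<forall>P\<in>set Ps. is_circ_perm_mat N P"
      "block N H i j = mat_sum_list N Ps"
      using assms ij unfolding is_simple_lift_def by blast
    obtain ss where ss: "Ps = map (circ_perm_mat N) ss" "set ss \<subseteq> {..<N}"
      using Ps(3) by (rule circ_perm_mat_list_shifts)
    have "H $$ (i * N + r, j * N + c) = length (filter (\<lambda>s. c = (r + s) mod N) ss)"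
      if "r < N" "c < N" for r c
    proof -
      have "block N H i j $$ (r, c) = mat_sum_list N (map (circ_perm_mat N) ss) $$ (r, c)"
        using Ps(4) ss(1) by simp
      with that show ?thesis by (simp add: block_def mat_sum_list_circ)
    qed
    with Ps ss show ?thesis by (intro exI[of _ ss]) (auto simp: distinct_map)
  qed
  then obtain ss where "\<forall>i j. i < dim_row B \<longrightarrow> j < dim_col B \<longrightarrow>
      length (ss i j) = B $$ (i, j) \<and> distinct (ss i j) \<and> set (ss i j) \<subseteq> {..<N} \<and>
      (\<forall>r<N. \<forall>c<N. H $$ (i * N + r, j * N + c) =
         length (filter (\<lambda>s. c = (r + s) mod N) (ss i j)))"
    by metis
  then show thesis by (intro that[of ss]) blast+
qed

section \<open>The permutation of indices inside blocks\<close>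

text \<open>In each of \<open>m\<close> blocks, an \<open>a\<close> by \<open>b\<close> array stored
  row by row is read as its transpose. The identity outside the range is what
  \<open>permutes\<close> demands.\<close>

definition block_transpose :: "nat \<Rightarrow> nat \<Rightarrow> nat \<Rightarrow> nat \<Rightarrow> nat" where
  "block_transpose m a b x =
     (if x < m * (a * b) then (x div b div a) * (a * b) + ((x mod b) * a + x div b mod a) else x)"

lemma block_transpose_digits:
  assumes "i < m" "u < a" "v < b"
  shows "block_transpose m a b (i * (a * b) + (u * b + v)) = i * (a * b) + (v * a + u)"
proof -
  have "i * (a * b) + (u * b + v) < m * (a * b)"
    using assms by (intro add_mult_less)
  moreover have eq: "i * (a * b) + (u * b + v) = (i * a + u) * b + v"
    by (simp add: algebra_simps)
  have "(i * (a * b) + (u * b + v)) div b = i * a + u" "(i * (a * b) + (u * b + v)) mod b = v"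
    unfolding eq using assms by simp_all
  ultimately show ?thesis
    using assms by (simp add: block_transpose_def)
qed

lemma digits_cases:
  fixes x m a b :: nat
  assumes "x < m * (a * b)"
  obtains i u v where "i < m" "u < a" "v < b" "x = i * (a * b) + (u * b + v)"
proof
  have pos: "a > 0" "b > 0" using assms by (auto intro: Nat.gr0I)
  show "x div b div a < m"
    using assms by (simp add: div_mult2_eq[symmetric] less_mult_imp_div_less mult.commute)
  show "x div b mod a < a" "x mod b < b" using pos by simp_all
  have "(x div b div a) * (a * b) + ((x div b mod a) * b + x mod b) =
      ((x div b div a) * a + x div b mod a) * b + x mod b"
    by (simp only: distrib_right mult.assoc add.assoc)
  also have "\<dots> = x" by (simp only: div_mult_mod_eq)
  finally show "x = (x div b div a) * (a * b) + ((x div b mod a) * b + x mod b)" ..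
qed

lemma block_transpose_permutes: "block_transpose m a b permutes {..<m * (a * b)}"
proof (rule bij_imp_permutes)
  \<comment> \<open>Transposing back means swapping \<open>a\<close> and \<open>b\<close>. With
    \<open>a\<close> and \<open>b\<close> general here, one fact gives both directions of the
    bijection.\<close>
  have inv: "block_transpose m b a (block_transpose m a b x) = x \<and>
      block_transpose m a b x < m * (a * b)" if "x < m * (a * b)" for a b x
  proof -
    obtain i u v where x: "i < m" "u < a" "v < b" "x = i * (a * b) + (u * b + v)"
      using \<open>x < m * (a * b)\<close> by (rule digits_cases)
    have "block_transpose m a b x = i * (b * a) + (v * a + u)"
      using block_transpose_digits[OF x(1-3)] x(4) by (simp add: mult.commute)
    moreover have "i * (b * a) + (v * a + u) < m * (b * a)"
      using x by (intro add_mult_less)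
    ultimately show ?thesis
      using block_transpose_digits[OF x(1,3,2)] x(4) by (simp add: mult.commute)
  qed
  show "bij_betw (block_transpose m a b) {..<m * (a * b)} {..<m * (a * b)}"
    using inv[of _ a b] inv[of _ b a]
    by (intro bij_betw_byWitness[where f' = "block_transpose m b a"])
      (auto simp: mult.commute[of b a])
  show "block_transpose m a b x = x" if "x \<notin> {..<m * (a * b)}" for x
    using that by (simp add: block_transpose_def)
qed

section \<open>The two lifting steps\<close>

text \<open>The shifts of a block of \<open>H\<close> that contribute to entry
  \<open>(u, u')\<close> of the corresponding pre-lifted block; the second lift replaces that entry
  by circulants built from these shifts.\<close>

definition entry_shifts :: "nat \<Rightarrow> nat list \<Rightarrow> nat \<Rightarrow> nat \<Rightarrow> nat list" where
  "entry_shifts N1 ss u u' = filter (\<lambda>s. u' = (u + s) mod N1) ss"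

theorem theorem49:
  fixes B H :: "nat mat" and N N1 N2 :: nat
  assumes "N1 \<ge> 1" and "N2 \<ge> 1" and "N = N1 * N2"
    and "qc_ldpc B N H"
  shows "\<exists>H'. prelifted_qc_ldpc B N1 N2 H' \<and> equivalent_pcm H H'"
proof -
  let ?m = "dim_row B" and ?n = "dim_col B"
  have lift: "is_simple_lift N B H" using assms(4) by (simp add: qc_ldpc_def)
  then have dims: "dim_row H = ?m * N" "dim_col H = ?n * N"
    by (auto simp: is_simple_lift_def)
  obtain ss where ss: "\<And>i j. i < ?m \<Longrightarrow> j < ?n \<Longrightarrow>
       length (ss i j) = B $$ (i, j) \<and> distinct (ss i j) \<and> set (ss i j) \<subseteq> {..<N}"
    and H: "\<And>i j r c. i < ?m \<Longrightarrow> j < ?n \<Longrightarrow> r < N \<Longrightarrow> c < N \<Longrightarrow>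
       H $$ (i * N + r, j * N + c) = length (filter (\<lambda>s. c = (r + s) mod N) (ss i j))"
    using lift by (rule simple_lift_shifts) blast
  let ?p = "block_transpose ?m N1 N2" and ?q = "block_transpose ?n N1 N2"
  define H1 where "H1 = mat (?m * N1) (?n * N1) (\<lambda>(x, y).
    length (entry_shifts N1 (ss (x div N1) (y div N1)) (x mod N1) (y mod N1)))"
  define H' where "H' = mat (dim_row H) (dim_col H) (\<lambda>(x, y). H $$ (?p x, ?q y))"
  have H1_entry: "H1 $$ (i * N1 + u, j * N1 + u') = length (entry_shifts N1 (ss i j) u u')"
    if "i < ?m" "j < ?n" "u < N1" "u' < N1" for i j u u'
    using that by (simp add: H1_def add_mult_less)
  have multi: "is_multi_lift N1 B H1"
    unfolding is_multi_lift_def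
  proof (intro conjI allI impI)
    show "H1 \<in> carrier_mat (?m * N1) (?n * N1)" by (simp add: H1_def)
    fix i j assume ij: "i < ?m" "j < ?n"
    \<comment> \<open>Distinct shifts may coincide modulo \<open>N1\<close>; a multi-lift allows
      such repetitions.\<close>
    let ?Ps = "map (circ_perm_mat N1) (map (\<lambda>s. s mod N1) (ss i j))"
    have "block N1 H1 i j = mat_sum_list N1 ?Ps"
      unfolding mat_sum_list_circ
      by (rule eq_matI)
        (simp_all add: block_def H1_entry ij entry_shifts_def filter_map o_def mod_add_right_eq)
    with ij ss show "\<exists>Ps. length Ps = B $$ (i, j) \<and> (\<forall>P\<in>set Ps. is_circ_perm_mat N1 P) \<and>
        block N1 H1 i j = mat_sum_list N1 Ps"
      by (intro exI[of _ ?Ps]) (use assms(1) in \<open>auto intro: is_circ_perm_mat_mod\<close>)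
  qed
  have simple: "is_simple_lift N2 H1 H'"
    unfolding is_simple_lift_def
  proof (intro conjI allI impI)
    show "H' \<in> carrier_mat (dim_row H1 * N2) (dim_col H1 * N2)"
      by (simp add: H'_def H1_def dims assms(3) mult.assoc)
    fix x y assume xy: "x < dim_row H1" "y < dim_col H1"
    define i u j u' where "i = x div N1" and "u = x mod N1" and "j = y div N1" and "u' = y mod N1"
    have b: "i < ?m" "j < ?n" "u < N1" "u' < N1" and x: "x = i * N1 + u" and y: "y = j * N1 + u'"
      using xy assms(1)
      by (simp_all add: i_def j_def u_def u'_def H1_def less_mult_imp_div_less)
    let ?shift = "\<lambda>s. (u + s) div N1 mod N2"
    let ?ts = "entry_shifts N1 (ss i j) u u'"
    let ?Ps = "map (circ_perm_mat N2) (map ?shift ?ts)"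
    \<comment> \<open>All \<open>u + s\<close> with \<open>s\<close> in \<open>?ts\<close> share the
      low digit \<open>u'\<close>. Equal images under \<open>?shift\<close> give equal high digits
      too, hence congruence modulo \<open>N\<close>, and \<open>u\<close> cancels.\<close>
    have "inj_on ?shift (set ?ts)"
    proof (rule inj_onI)
      fix s t assume st: "s \<in> set ?ts" "t \<in> set ?ts" and eq: "?shift s = ?shift t"
      have "(u + s) mod N = (u + t) mod N"
        using st eq by (simp add: assms(3) mod_mult2_eq entry_shifts_def)
      moreover have "s < N" "t < N" using st ss[OF b(1,2)] by (auto simp: entry_shifts_def)
      ultimately show "s = t" by (rule mod_add_left_inj)
    qed
    then have "distinct (map ?shift ?ts)"
      using ss[OF b(1,2)] by (simp add: distinct_map entry_shifts_def)
    moreover have "inj_on (circ_perm_mat N2) (set (map ?shift ?ts))"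
      using circ_perm_mat_inj_on by (rule inj_on_subset) (use assms(2) in auto)
    ultimately have "distinct ?Ps" by (simp only: distinct_map)
    moreover have "block N2 H' x y = mat_sum_list N2 ?Ps"
      unfolding mat_sum_list_circ
    proof (rule eq_matI)
      fix v v' assume "v < dim_row (mat N2 N2 (\<lambda>(r, c).
          length (filter (\<lambda>s. c = (r + s) mod N2) (map ?shift ?ts))))"
        "v' < dim_col (mat N2 N2 (\<lambda>(r, c).
          length (filter (\<lambda>s. c = (r + s) mod N2) (map ?shift ?ts))))"
      then have v: "v < N2" "v' < N2" by simp_all
      \<comment> \<open>Block \<open>x\<close> of size \<open>N2\<close> is the \<open>u\<close>-th
        slice of block \<open>i\<close> of size \<open>N\<close>.\<close>
      have pos: "x * N2 + v = i * N + (u * N2 + v)" "y * N2 + v' = j * N + (u' * N2 + v')"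
        by (simp_all add: x y assms(3) algebra_simps)
      have inner: "u * N2 + v < N" "u' * N2 + v' < N"
        using b v by (simp_all add: assms(3) add_mult_less)
      have inner': "v * N1 + u < N" "v' * N1 + u' < N"
        using b v by (simp_all add: assms(3) mult.commute[of N1 N2] add_mult_less)
      \<comment> \<open>The multiple \<open>v * N1\<close> leaves the low digit of
        \<open>u + s\<close> alone; the carry \<open>(u + s) div N1\<close> is added to
        \<open>v\<close>.\<close>
      have digits: "v' * N1 + u' = (v * N1 + u + s) mod N \<longleftrightarrow>
          u' = (u + s) mod N1 \<and> v' = (v + ?shift s) mod N2" for s
      proof -
        have eq: "v * N1 + u + s = (u + s) + v * N1" by simp
        have "(v * N1 + u + s) mod N1 = (u + s) mod N1"
          and "(v * N1 + u + s) div N1 = v + (u + s) div N1"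
          unfolding eq using assms(1) by simp_all
        then show ?thesis
          by (simp only: assms(3) digits_eq_mod_iff[OF b(4)] mod_add_right_eq)
      qed
      have "block N2 H' x y $$ (v, v') = H' $$ (i * N + (u * N2 + v), j * N + (u' * N2 + v'))"
        using v by (simp add: block_def pos)
      also have "\<dots> = H $$ (?p (i * N + (u * N2 + v)), ?q (j * N + (u' * N2 + v')))"
        using b inner by (simp add: H'_def dims add_mult_less)
      also have "\<dots> = H $$ (i * N + (v * N1 + u), j * N + (v' * N1 + u'))"
        using b v by (simp add: assms(3) block_transpose_digits)
      also have "\<dots> = length (filter (\<lambda>s. v' * N1 + u' = (v * N1 + u + s) mod N) (ss i j))"
        using b inner' by (intro H)
      \<comment> \<open>By \<open>digits\<close>, the filter splits in two: the condition on
        \<open>u'\<close> selects \<open>?ts\<close>, and the condition on \<open>v'\<close> counts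
        within it.\<close>
      also have "\<dots> = length (filter (\<lambda>s. v' = (v + s) mod N2) (map ?shift ?ts))"
        by (simp add: digits entry_shifts_def filter_map o_def conj_commute)
      finally show "block N2 H' x y $$ (v, v') = mat N2 N2 (\<lambda>(r, c).
          length (filter (\<lambda>s. c = (r + s) mod N2) (map ?shift ?ts))) $$ (v, v')"
        using v by simp
    qed (simp_all add: block_def)
    moreover have "length ?Ps = H1 $$ (x, y)"
      using H1_entry[OF b] by (simp add: x y)
    moreover have "\<forall>P\<in>set ?Ps. is_circ_perm_mat N2 P"
      using assms(2) by (auto intro: is_circ_perm_mat_mod)
    ultimately show "\<exists>Ps. length Ps = H1 $$ (x, y) \<and> distinct Ps \<and>
        (\<forall>P\<in>set Ps. is_circ_perm_mat N2 P) \<and> block N2 H' x y = mat_sum_list N2 Ps"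
      by blast
  qed
  have "equivalent_pcm H H'"
    unfolding equivalent_pcm_def
  proof (intro exI conjI)
    show "?p permutes {..<dim_row H}" "?q permutes {..<dim_col H}"
      using block_transpose_permutes by (simp_all add: dims assms(3))
  qed (rule H'_def)
  with multi simple show ?thesis
    unfolding prelifted_qc_ldpc_def by blast
qed

end
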